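(* Let $G$ be a graph and $F$ a set of nonedges of $G$ such that $G\cup F$ is a partial $3$-tree. Then $(G,F)$ has the $3$-covering map property: for every $\ell:E(G)\to\mathbb{R}_{\ge0}$, the image under the Cayley map $\phi_F$ of every connected component of $\mathcal{C}^3(G,\ell)$ equals $\Omega^3_F(G,\ell)$.
   Context: A linkage $(G,\ell)$: finite simple graph $G$ and $\ell:E(G)\to\mathbb{R}_{\ge0}$ (squared lengths). A $3$-realization is $p:V(G)\to\mathbb{R}^3$ with $\|p(x)-p(y)\|^2=\ell(xy)$ for all $xy\in E(G)$; $\mathcal{C}^3(G,\ell)\subseteq(\mathbb{R}^3)^{V(G)}$ is the set of these (with the subspace topology). For an indexed set $F=\{u_1v_1,\dots,u_mv_m\}$ of nonedges, $\phi_F(p)=(\|p(u_i)-p(v_i)\|^2)_{i}$ and $\Omega^3_F(G,\ell)=\phi_F(\mathcal{C}^3(G,\ell))$. $G\cup F$ is $G$ with the pairs of $F$ added as edges. A $3$-tree is $K_4$ or is obtained from a $3$-tree by adding a new vertex adjacent to exactly the three vertices of some triangle; a partial $3$-tree is a subgraph of a $3$-tree. *)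

theory Defs
  imports "HOL-Analysis.Analysis"
begin

definition simple_graph :: "'a set \<Rightarrow> 'a set set \<Rightarrow> bool" where
  "simple_graph V E \<longleftrightarrow> finite V \<and> (\<forall>e\<in>E. e \<subseteq> V \<and> card e = 2)"

inductive three_tree :: "nat set \<Rightarrow> nat set set \<Rightarrow> bool" where
  K4: "card V = 4 \<Longrightarrow> E = {e. e \<subseteq> V \<and> card e = 2} \<Longrightarrow> three_tree V E"
| add: "three_tree V E \<Longrightarrow> a \<in> V \<Longrightarrow> b \<in> V \<Longrightarrow> c \<in> V \<Longrightarrow>
        a \<noteq> b \<Longrightarrow> b \<noteq> c \<Longrightarrow> a \<noteq> c \<Longrightarrow>
        {a,b} \<in> E \<Longrightarrow> {b,c} \<in> E \<Longrightarrow> {a,c} \<in> E \<Longrightarrow> v \<notin> V \<Longrightarrow>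
        three_tree (insert v V) (E \<union> {{v,a},{v,b},{v,c}})"

definition partial_three_tree :: "'a set \<Rightarrow> 'a set set \<Rightarrow> bool" where
  "partial_three_tree V E \<longleftrightarrow>
     (\<exists>TV TE f. three_tree TV TE \<and> inj_on f V \<and> f ` V \<subseteq> TV \<and> (\<forall>e\<in>E. f ` e \<in> TE))"

definition nonedges :: "'a set \<Rightarrow> 'a set set \<Rightarrow> ('a \<times> 'a) list \<Rightarrow> bool" where
  "nonedges V E F \<longleftrightarrow>
     (\<forall>(u,v)\<in>set F. u \<in> V \<and> v \<in> V \<and> u \<noteq> v \<and> {u,v} \<notin> E)
     \<and> distinct (map (\<lambda>(u,v). {u,v}) F)"

definition graph_union :: "'a set set \<Rightarrow> ('a \<times> 'a) list \<Rightarrow> 'a set set" where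
  "graph_union E F = E \<union> (\<lambda>(u,v). {u,v}) ` set F"

text \<open>Space of 3-realizations: maps V \<rightarrow> R^3 (extended by 0 off V, so that the
  product topology on 'a \<Rightarrow> real^3 restricts to the topology of (R^3)^V).\<close>
definition config3 :: "'a set \<Rightarrow> 'a set set \<Rightarrow> ('a set \<Rightarrow> real) \<Rightarrow> ('a \<Rightarrow> real^3) set" where
  "config3 V E l = {p. (\<forall>x. x \<notin> V \<longrightarrow> p x = 0) \<and>
      (\<forall>e\<in>E. \<forall>x y. e = {x,y} \<longrightarrow> (norm (p x - p y))^2 = l e)}"

definition cayley_map :: "('a \<times> 'a) list \<Rightarrow> ('a \<Rightarrow> real^3) \<Rightarrow> real list" where
  "cayley_map F p = map (\<lambda>(u,v). (norm (p u - p v))^2) F"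

definition Omega3 :: "'a set \<Rightarrow> 'a set set \<Rightarrow> ('a set \<Rightarrow> real) \<Rightarrow> ('a \<times> 'a) list \<Rightarrow> real list set" where
  "Omega3 V E l F = cayley_map F ` config3 V E l"

definition covering_map_property3 :: "'a set \<Rightarrow> 'a set set \<Rightarrow> ('a \<times> 'a) list \<Rightarrow> bool" where
  "covering_map_property3 V E F \<longleftrightarrow>
     (\<forall>l. (\<forall>e\<in>E. l e \<ge> 0) \<longrightarrow>
        (\<forall>p\<in>config3 V E l.
           cayley_map F ` connected_component_set (config3 V E l) p = Omega3 V E l F))"

end

theory Submission
  imports Defs
begin

text \<open>
  Let \<open>p\<close> and \<open>q\<close> realize a 3-tree containing \<open>G \<union> F\<close>. The configurations \<open>(\<surd>(1 - t) p, \<surd>t q)\<close>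
  in six-dimensional space interpolate the squared lengths linearly, so edges on which \<open>p\<close> and \<open>q\<close>
  agree keep their length. If no three points of \<open>p\<close> or of \<open>q\<close> are collinear, no triangle
  degenerates along the way, and building up the 3-tree vertex by vertex gives a continuous path of
  configurations in three-dimensional space with these lengths, starting at \<open>p\<close>: each new vertex
  is folded about the plane of the triangle to which it is attached.

  In general, perturb \<open>p\<close> and \<open>q\<close> into general position. The path then keeps the common lengths up
  to \<open>\<epsilon>\<close> and reaches the lengths of \<open>q\<close> up to \<open>\<epsilon>\<close>. All this happens in a fixed compact set, so
  letting \<open>\<epsilon>\<close> tend to 0 yields a decreasing sequence of continua through \<open>p\<close>, whose intersection is
  a continuum containing a configuration with exactly the lengths of \<open>q\<close>.
\<close>

unbundle cross3_syntax

section \<open>Folding about a plane\<close>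

definition orthonormal_pair :: "'h::real_inner \<Rightarrow> 'h \<Rightarrow> bool" where
  "orthonormal_pair e f \<longleftrightarrow> norm e = 1 \<and> norm f = 1 \<and> e \<bullet> f = 0"

lemma norm_sq_orthonormal_pair_plus_orthogonal:
  assumes "orthonormal_pair e f" "z \<bullet> e = 0" "z \<bullet> f = 0"
  shows "(norm (a *\<^sub>R e + b *\<^sub>R f + z))\<^sup>2 = a\<^sup>2 + b\<^sup>2 + (norm z)\<^sup>2"
proof -
  have "e \<bullet> e = 1" "f \<bullet> f = 1" "e \<bullet> f = 0"
    using assms(1) by (simp_all add: orthonormal_pair_def norm_eq_1)
  then show ?thesis
    using assms(2,3) unfolding power2_norm_eq_inner
    by (simp add: inner_add_left inner_add_right inner_commute power2_eq_square)
qed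

lemma norm_orthonormal_pair_cong:
  assumes "orthonormal_pair e f" "orthonormal_pair E F"
  shows "norm (a *\<^sub>R e + b *\<^sub>R f) = norm (a *\<^sub>R E + b *\<^sub>R F)"
  using norm_sq_orthonormal_pair_plus_orthogonal[OF assms(1), of 0 a b]
    norm_sq_orthonormal_pair_plus_orthogonal[OF assms(2), of 0 a b]
  by (simp add: power2_eq_imp_eq)

definition plane_residual :: "'h::real_inner \<Rightarrow> 'h \<Rightarrow> 'h \<Rightarrow> 'h" where
  "plane_residual e f x = x - (x \<bullet> e) *\<^sub>R e - (x \<bullet> f) *\<^sub>R f"

lemma plane_residual_orthogonal:
  assumes "orthonormal_pair e f"
  shows "plane_residual e f x \<bullet> e = 0" "plane_residual e f x \<bullet> f = 0"
  using assms
  by (simp_all add: plane_residual_def orthonormal_pair_def norm_eq_1 inner_diff_left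
      inner_diff_right inner_commute)

lemma norm_sq_diff_plane:
  assumes "orthonormal_pair e f"
  shows "(norm (x - (a *\<^sub>R e + b *\<^sub>R f)))\<^sup>2 =
    (x \<bullet> e - a)\<^sup>2 + (x \<bullet> f - b)\<^sup>2 + (norm (plane_residual e f x))\<^sup>2"
proof -
  have "x - (a *\<^sub>R e + b *\<^sub>R f) = (x \<bullet> e - a) *\<^sub>R e + (x \<bullet> f - b) *\<^sub>R f + plane_residual e f x"
    by (simp add: plane_residual_def algebra_simps)
  then show ?thesis
    using norm_sq_orthonormal_pair_plus_orthogonal[OF assms plane_residual_orthogonal[OF assms]]
    by simp
qed

lemma norm_cross_orthonormal_pair:
  assumes "orthonormal_pair e f"
  shows "norm (e \<times> f) = 1"
proof -
  have "(norm (e \<times> f))\<^sup>2 = 1\<^sup>2"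
    using norm_cross_dot[of e f] assms by (simp add: orthonormal_pair_def)
  then show ?thesis
    by (rule power2_eq_imp_eq) simp_all
qed

lemma plane_residual_eq_normal_component:
  fixes e f :: "real^3"
  assumes "orthonormal_pair e f"
  shows "plane_residual e f x = (x \<bullet> (e \<times> f)) *\<^sub>R (e \<times> f)"
proof -
  define n where "n = e \<times> f"
  define z where "z = plane_residual e f x"
  have nn: "n \<bullet> n = 1"
    unfolding n_def using norm_cross_orthonormal_pair[OF assms] norm_eq_1 by blast
  have "n \<times> (z \<times> n) = 0"
    using plane_residual_orthogonal[OF assms, of x] by (simp add: n_def z_def Lagrange)
  then have "z = (z \<bullet> n) *\<^sub>R n"
    using nn by (simp add: Lagrange inner_commute)
  moreover have "z \<bullet> n = x \<bullet> n"
    by (simp add: z_def n_def plane_residual_def inner_diff_left dot_cross_self)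
  ultimately show ?thesis
    by (simp add: z_def n_def)
qed

text \<open>Carries the plane of \<open>E\<close> and \<open>F\<close> to that of \<open>e\<close> and \<open>f\<close> and rotates the rest of the ambient
  space about it into a closed half-space, whose side is selected by the sign \<open>s\<close>.\<close>

definition plane_fold :: "'h::real_inner \<Rightarrow> 'h \<Rightarrow> real^3 \<Rightarrow> real^3 \<Rightarrow> real \<Rightarrow> 'h \<Rightarrow> real^3" where
  "plane_fold E F e f s X =
    (X \<bullet> E) *\<^sub>R e + (X \<bullet> F) *\<^sub>R f + (s * norm (plane_residual E F X)) *\<^sub>R (e \<times> f)"

lemma dist_plane_fold:
  assumes ef: "orthonormal_pair e f" and EF: "orthonormal_pair E F" and s: "\<bar>s\<bar> = 1"
  shows "dist (plane_fold E F e f s X) (a *\<^sub>R e + b *\<^sub>R f) = dist X (a *\<^sub>R E + b *\<^sub>R F)"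
proof -
  let ?z = "(s * norm (plane_residual E F X)) *\<^sub>R (e \<times> f)"
  have "plane_fold E F e f s X - (a *\<^sub>R e + b *\<^sub>R f)
      = (X \<bullet> E - a) *\<^sub>R e + (X \<bullet> F - b) *\<^sub>R f + ?z"
    by (simp add: plane_fold_def algebra_simps)
  moreover have "norm ?z = norm (plane_residual E F X)"
    using s by (simp add: abs_mult norm_cross_orthonormal_pair[OF ef])
  moreover have "?z \<bullet> e = 0" "?z \<bullet> f = 0"
    by (simp_all add: dot_cross_self)
  ultimately have "(dist (plane_fold E F e f s X) (a *\<^sub>R e + b *\<^sub>R f))\<^sup>2 =
      (dist X (a *\<^sub>R E + b *\<^sub>R F))\<^sup>2"
    by (simp add: dist_norm norm_sq_orthonormal_pair_plus_orthogonal[OF ef]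
        norm_sq_diff_plane[OF EF])
  then show ?thesis
    by simp
qed

lemma norm_plane_fold:
  assumes "orthonormal_pair e f" "orthonormal_pair E F" "\<bar>s\<bar> = 1"
  shows "norm (plane_fold E F e f s X) = norm X"
  using dist_plane_fold[OF assms, of X 0 0] by simp

lemma plane_fold_surj:
  assumes ef: "orthonormal_pair e f" and EF: "orthonormal_pair E F"
    and x: "norm x = norm X" "x \<bullet> e = X \<bullet> E" "x \<bullet> f = X \<bullet> F"
  obtains s where "\<bar>s\<bar> = 1" "plane_fold E F e f s X = x"
proof -
  define h where "h = x \<bullet> (e \<times> f)"
  define s :: real where "s = (if h < 0 then -1 else 1)"
  have res: "plane_residual e f x = h *\<^sub>R (e \<times> f)"
    unfolding h_def by (rule plane_residual_eq_normal_component[OF ef])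
  have "(norm (plane_residual e f x))\<^sup>2 = (norm (plane_residual E F X))\<^sup>2"
    using norm_sq_diff_plane[OF ef, of x 0 0] norm_sq_diff_plane[OF EF, of X 0 0] x by simp
  then have "norm (plane_residual e f x) = norm (plane_residual E F X)"
    by simp
  then have "norm (plane_residual E F X) = \<bar>h\<bar>"
    by (simp add: res norm_cross_orthonormal_pair[OF ef])
  then have "s * norm (plane_residual E F X) = h"
    by (simp add: s_def)
  moreover have "x = (x \<bullet> e) *\<^sub>R e + (x \<bullet> f) *\<^sub>R f + plane_residual e f x"
    by (simp add: plane_residual_def)
  ultimately have "plane_fold E F e f s X = x"
    using res x(2,3) by (simp add: plane_fold_def)
  then show thesis
    by (intro that[of s]) (simp_all add: s_def)
qed

lemma continuous_on_plane_fold [continuous_intros]: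
  fixes X :: "'t::t2_space \<Rightarrow> 'h::real_inner"
  assumes "continuous_on T E" "continuous_on T F" "continuous_on T e" "continuous_on T f"
    "continuous_on T X"
  shows "continuous_on T (\<lambda>t. plane_fold (E t) (F t) (e t) (f t) s (X t))"
  unfolding plane_fold_def plane_residual_def
  by (intro continuous_intros continuous_on_cross assms)

section \<open>Congruent triangles\<close>

definition rejection :: "'h::real_inner \<Rightarrow> 'h \<Rightarrow> 'h" where
  "rejection u w = w - (w \<bullet> sgn u) *\<^sub>R sgn u"

lemma norm_scaleR_sgn: "norm x *\<^sub>R sgn x = x" for x :: "'h::real_normed_vector"
  by (cases "x = 0") (simp_all add: sgn_div_norm)

lemma projection_plus_rejection:
  "(w \<bullet> sgn u) *\<^sub>R sgn u + norm (rejection u w) *\<^sub>R sgn (rejection u w) = w"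
  by (simp add: norm_scaleR_sgn) (simp add: rejection_def)

lemma orthonormal_pair_sgn_rejection:
  assumes "u \<noteq> 0" "rejection u w \<noteq> 0"
  shows "orthonormal_pair (sgn u) (sgn (rejection u w))"
proof -
  have "sgn u \<bullet> sgn u = 1"
    using assms(1) by (simp add: norm_sgn flip: norm_eq_1)
  then have "sgn u \<bullet> rejection u w = 0"
    by (simp add: rejection_def inner_diff_right inner_commute)
  then show ?thesis
    using assms by (simp add: orthonormal_pair_def norm_sgn sgn_div_norm[of "rejection u w"])
qed

lemma noncollinear_imp_rejection_nonzero:
  assumes "\<not> collinear {0, u, w}"
  shows "u \<noteq> 0" "rejection u w \<noteq> 0"
proof -
  show "u \<noteq> 0"
    using assms by (auto simp: collinear_lemma)
  show "rejection u w \<noteq> 0"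
  proof
    assume "rejection u w = 0"
    then have "w = ((w \<bullet> sgn u) / norm u) *\<^sub>R u"
      by (simp add: rejection_def sgn_div_norm divide_inverse)
    then show False
      using assms by (metis collinear_lemma)
  qed
qed

lemma norm_sq_rejection:
  assumes "u \<noteq> 0"
  shows "(norm (rejection u w))\<^sup>2 = (norm w)\<^sup>2 - (w \<bullet> sgn u)\<^sup>2"
proof -
  have "sgn u \<bullet> sgn u = 1"
    using assms by (simp add: norm_sgn flip: norm_eq_1)
  then show ?thesis
    unfolding power2_norm_eq_inner rejection_def
    by (simp add: inner_diff_left inner_diff_right inner_commute power2_eq_square)
qed

lemma inner_sgn_rejection:
  "x \<bullet> sgn (rejection u w) = (x \<bullet> w - (w \<bullet> sgn u) * (x \<bullet> sgn u)) / norm (rejection u w)"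
  by (simp add: sgn_div_norm[of "rejection u w"])
    (simp add: rejection_def inner_diff_right divide_inverse mult.commute)

lemma continuous_on_rejection [continuous_intros]:
  assumes "continuous_on T u" "continuous_on T w" "\<And>t. t \<in> T \<Longrightarrow> u t \<noteq> 0"
  shows "continuous_on T (\<lambda>t. rejection (u t) (w t))"
  unfolding rejection_def using assms by (intro continuous_intros) auto

definition congruent_pairs :: "'g::real_inner \<Rightarrow> 'g \<Rightarrow> 'h::real_inner \<Rightarrow> 'h \<Rightarrow> bool" where
  "congruent_pairs u w U W \<longleftrightarrow> norm u = norm U \<and> norm w = norm W \<and> dist u w = dist U W"

lemma congruent_pairs_diff:
  "congruent_pairs (b - a) (c - a) (B - A) (C - A) \<longleftrightarrow>
    dist a b = dist A B \<and> dist a c = dist A C \<and> dist b c = dist B C"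
  by (simp add: congruent_pairs_def dist_norm norm_minus_commute)

lemma inner_eq_if_congruent_pairs: "congruent_pairs u w U W \<Longrightarrow> u \<bullet> w = U \<bullet> W"
  by (simp add: congruent_pairs_def dot_norm_neg dist_norm)

lemma congruent_pairs_coordinates:
  assumes "congruent_pairs u w U W"
  shows "norm u = norm U" "w \<bullet> sgn u = W \<bullet> sgn U" "norm (rejection u w) = norm (rejection U W)"
proof -
  show norm_u: "norm u = norm U"
    using assms by (simp add: congruent_pairs_def)
  have "w \<bullet> u = W \<bullet> U"
    using inner_eq_if_congruent_pairs[OF assms] by (simp add: inner_commute)
  then show inner_w: "w \<bullet> sgn u = W \<bullet> sgn U"
    by (simp add: sgn_div_norm norm_u)
  have norm_w: "norm w = norm W"
    using assms by (simp add: congruent_pairs_def)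
  show "norm (rejection u w) = norm (rejection U W)"
  proof (cases "u = 0")
    case True
    then show ?thesis
      using norm_u norm_w by (simp add: rejection_def)
  next
    case False
    then have "(norm (rejection u w))\<^sup>2 = (norm (rejection U W))\<^sup>2"
      using norm_u norm_w inner_w by (metis norm_sq_rejection norm_eq_zero)
    then show ?thesis
      by simp
  qed
qed

lemma congruent_pairs_orthonormal_coordinates:
  assumes ef: "orthonormal_pair e f" and nonzero: "U \<noteq> 0" "rejection U W \<noteq> 0"
  shows "congruent_pairs (norm U *\<^sub>R e) ((W \<bullet> sgn U) *\<^sub>R e + norm (rejection U W) *\<^sub>R f) U W"
proof -
  define E F where "E = sgn U" and "F = sgn (rejection U W)"
  define a b c where "a = norm U" and "b = W \<bullet> E" and "c = norm (rejection U W)"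
  have EF: "orthonormal_pair E F"
    unfolding E_def F_def by (rule orthonormal_pair_sgn_rejection[OF nonzero])
  have U: "U = a *\<^sub>R E" and W: "W = b *\<^sub>R E + c *\<^sub>R F"
    by (simp_all only: a_def b_def c_def E_def F_def norm_scaleR_sgn[of U]
        projection_plus_rejection)
  have "a *\<^sub>R e - (b *\<^sub>R e + c *\<^sub>R f) = (a - b) *\<^sub>R e + (- c) *\<^sub>R f"
      "a *\<^sub>R E - (b *\<^sub>R E + c *\<^sub>R F) = (a - b) *\<^sub>R E + (- c) *\<^sub>R F"
    by (simp_all add: algebra_simps)
  then have "dist (a *\<^sub>R e) (b *\<^sub>R e + c *\<^sub>R f) = dist (a *\<^sub>R E) (b *\<^sub>R E + c *\<^sub>R F)"
    by (simp only: dist_norm norm_orthonormal_pair_cong[OF ef EF])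
  moreover have "norm (b *\<^sub>R e + c *\<^sub>R f) = norm (b *\<^sub>R E + c *\<^sub>R F)"
    by (rule norm_orthonormal_pair_cong[OF ef EF])
  moreover have "norm (a *\<^sub>R e) = norm (a *\<^sub>R E)"
    using ef EF by (simp add: orthonormal_pair_def)
  ultimately have "congruent_pairs (a *\<^sub>R e) (b *\<^sub>R e + c *\<^sub>R f) U W"
    unfolding congruent_pairs_def using U W by simp
  then show ?thesis
    by (simp only: a_def b_def c_def E_def)
qed

lemma congruent_pairs_path:
  fixes U W :: "'t::topological_space \<Rightarrow> 'h::real_inner" and u0 w0 :: "'g::real_inner"
  assumes cont: "continuous_on T U" "continuous_on T W"
    and noncollinear: "\<And>t. t \<in> T \<Longrightarrow> \<not> collinear {0, U t, W t}"
    and t0: "t0 \<in> T" and start: "congruent_pairs u0 w0 (U t0) (W t0)"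
  obtains u w where "continuous_on T u" "continuous_on T w" "u t0 = u0" "w t0 = w0"
    "\<And>t. t \<in> T \<Longrightarrow> congruent_pairs (u t) (w t) (U t) (W t)"
proof -
  define e f where "e = sgn u0" and "f = sgn (rejection u0 w0)"
  define u where "u t = norm (U t) *\<^sub>R e" for t
  define w where "w t = (W t \<bullet> sgn (U t)) *\<^sub>R e + norm (rejection (U t) (W t)) *\<^sub>R f" for t
  note nonzero = noncollinear_imp_rejection_nonzero[OF noncollinear]
  note coordinates = congruent_pairs_coordinates[OF start]
  have ef: "orthonormal_pair e f"
    unfolding e_def f_def using nonzero[OF t0] coordinates(1,3)
    by (intro orthonormal_pair_sgn_rejection) auto
  show thesis
  proof
    show "continuous_on T u"
      unfolding u_def by (intro continuous_intros cont)
    show "continuous_on T w"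
      unfolding w_def using cont nonzero(1) by (intro continuous_intros) auto
    show "u t0 = u0"
      by (simp add: u_def e_def norm_scaleR_sgn flip: coordinates(1))
    show "w t0 = w0"
      unfolding w_def e_def f_def coordinates(2,3)[symmetric] by (rule projection_plus_rejection)
    show "congruent_pairs (u t) (w t) (U t) (W t)" if "t \<in> T" for t
      unfolding u_def w_def
      by (rule congruent_pairs_orthonormal_coordinates[OF ef nonzero[OF that]])
  qed
qed

lemma congruent_pairs_fold:
  fixes u w :: "real^3" and X U W :: "'h::real_inner"
  assumes nonzero: "U \<noteq> 0" "rejection U W \<noteq> 0" and base: "congruent_pairs u w U W" and s: "\<bar>s\<bar> = 1"
  defines "x \<equiv> plane_fold (sgn U) (sgn (rejection U W)) (sgn u) (sgn (rejection u w)) s X"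
  shows "congruent_pairs x u X U" "congruent_pairs x w X W"
proof -
  note coordinates = congruent_pairs_coordinates[OF base]
  have EF: "orthonormal_pair (sgn U) (sgn (rejection U W))"
    by (rule orthonormal_pair_sgn_rejection[OF nonzero])
  have ef: "orthonormal_pair (sgn u) (sgn (rejection u w))"
    using nonzero coordinates by (intro orthonormal_pair_sgn_rejection) auto
  have "dist x u = dist X U"
    using dist_plane_fold[OF ef EF s, of X "norm U" 0] coordinates(1) norm_scaleR_sgn[of u]
    by (simp add: x_def norm_scaleR_sgn)
  moreover have "dist x w = dist X W"
    using dist_plane_fold[OF ef EF s, of X "W \<bullet> sgn U" "norm (rejection U W)"] coordinates(2,3)
      projection_plus_rejection[of w u] projection_plus_rejection[of W U]
    by (simp add: x_def)
  moreover have "norm x = norm X"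
    unfolding x_def by (rule norm_plane_fold[OF ef EF s])
  ultimately show "congruent_pairs x u X U" "congruent_pairs x w X W"
    using base by (simp_all add: congruent_pairs_def)
qed

lemma congruent_pairs_fold_surj:
  fixes x u w :: "real^3" and X U W :: "'h::real_inner"
  assumes nonzero: "U \<noteq> 0" "rejection U W \<noteq> 0" and base: "congruent_pairs u w U W"
    and x: "congruent_pairs x u X U" "congruent_pairs x w X W"
  obtains s where "\<bar>s\<bar> = 1"
    "plane_fold (sgn U) (sgn (rejection U W)) (sgn u) (sgn (rejection u w)) s X = x"
proof -
  note coordinates = congruent_pairs_coordinates[OF base]
  have inner_u: "x \<bullet> sgn u = X \<bullet> sgn U"
    using inner_eq_if_congruent_pairs[OF x(1)] coordinates(1) by (simp add: sgn_div_norm)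
  then have inner_w: "x \<bullet> sgn (rejection u w) = X \<bullet> sgn (rejection U W)"
    using inner_eq_if_congruent_pairs[OF x(2)] coordinates(2,3) by (simp add: inner_sgn_rejection)
  have ef: "orthonormal_pair (sgn u) (sgn (rejection u w))"
    using nonzero coordinates by (intro orthonormal_pair_sgn_rejection) auto
  have "norm x = norm X"
    using x(1) by (simp add: congruent_pairs_def)
  from plane_fold_surj[OF ef orthonormal_pair_sgn_rejection[OF nonzero] this inner_u inner_w] that
  show thesis .
qed

lemma congruent_triples_path:
  fixes u w :: "'t::t2_space \<Rightarrow> real^3" and U W X :: "'t \<Rightarrow> 'h::real_inner"
  assumes cont: "continuous_on T u" "continuous_on T w"
      "continuous_on T U" "continuous_on T W" "continuous_on T X"
    and noncollinear: "\<And>t. t \<in> T \<Longrightarrow> \<not> collinear {0, U t, W t}"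
    and base: "\<And>t. t \<in> T \<Longrightarrow> congruent_pairs (u t) (w t) (U t) (W t)"
    and t0: "t0 \<in> T"
    and start: "congruent_pairs x0 (u t0) (X t0) (U t0)" "congruent_pairs x0 (w t0) (X t0) (W t0)"
  obtains x where "continuous_on T x" "x t0 = x0"
    "\<And>t. t \<in> T \<Longrightarrow> congruent_pairs (x t) (u t) (X t) (U t)"
    "\<And>t. t \<in> T \<Longrightarrow> congruent_pairs (x t) (w t) (X t) (W t)"
proof -
  note nonzero = noncollinear_imp_rejection_nonzero[OF noncollinear]
  have nonzero': "u t \<noteq> 0" "rejection (u t) (w t) \<noteq> 0" if "t \<in> T" for t
    using nonzero[OF that] congruent_pairs_coordinates(1,3)[OF base[OF that]] by auto
  obtain s where s: "\<bar>s\<bar> = 1"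
    "plane_fold (sgn (U t0)) (sgn (rejection (U t0) (W t0))) (sgn (u t0))
      (sgn (rejection (u t0) (w t0))) s (X t0) = x0"
    using congruent_pairs_fold_surj[OF nonzero[OF t0] base[OF t0] start] by blast
  define x where "x t = plane_fold (sgn (U t)) (sgn (rejection (U t) (W t))) (sgn (u t))
      (sgn (rejection (u t) (w t))) s (X t)" for t
  show thesis
  proof
    show "continuous_on T x"
      unfolding x_def using cont nonzero nonzero' by (intro continuous_intros) auto
    show "x t0 = x0"
      by (simp add: x_def s(2))
    show "congruent_pairs (x t) (u t) (X t) (U t)" "congruent_pairs (x t) (w t) (X t) (W t)"
      if "t \<in> T" for t
      unfolding x_def using congruent_pairs_fold[OF nonzero[OF that] base[OF that] s(1)] by auto
  qed
qed

lemma collinear_iff_diffs: "collinear {a, b, c} \<longleftrightarrow> collinear {0, b - a, c - a}"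
  using collinear_3[of b a c] by (simp add: NO_MATCH_def insert_commute)

lemma attached_point_path:
  fixes a b c :: "'t::t2_space \<Rightarrow> real^3" and A B C X :: "'t \<Rightarrow> 'h::real_inner"
  assumes cont: "continuous_on T a" "continuous_on T b" "continuous_on T c"
      "continuous_on T A" "continuous_on T B" "continuous_on T C" "continuous_on T X"
    and noncollinear: "\<And>t. t \<in> T \<Longrightarrow> \<not> collinear {A t, B t, C t}"
    and base: "\<And>t. t \<in> T \<Longrightarrow> dist (a t) (b t) = dist (A t) (B t)"
      "\<And>t. t \<in> T \<Longrightarrow> dist (a t) (c t) = dist (A t) (C t)"
      "\<And>t. t \<in> T \<Longrightarrow> dist (b t) (c t) = dist (B t) (C t)"
    and t0: "t0 \<in> T"
    and start: "dist x0 (a t0) = dist (X t0) (A t0)" "dist x0 (b t0) = dist (X t0) (B t0)"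
      "dist x0 (c t0) = dist (X t0) (C t0)"
  obtains x where "continuous_on T x" "x t0 = x0"
    "\<And>t. t \<in> T \<Longrightarrow> dist (x t) (a t) = dist (X t) (A t)"
    "\<And>t. t \<in> T \<Longrightarrow> dist (x t) (b t) = dist (X t) (B t)"
    "\<And>t. t \<in> T \<Longrightarrow> dist (x t) (c t) = dist (X t) (C t)"
proof -
  obtain y where y: "continuous_on T y" "y t0 = x0 - a t0"
      "\<And>t. t \<in> T \<Longrightarrow> congruent_pairs (y t) (b t - a t) (X t - A t) (B t - A t)"
      "\<And>t. t \<in> T \<Longrightarrow> congruent_pairs (y t) (c t - a t) (X t - A t) (C t - A t)"
  proof (rule congruent_triples_path[of T "\<lambda>t. b t - a t" "\<lambda>t. c t - a t" "\<lambda>t. B t - A t"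
        "\<lambda>t. C t - A t" "\<lambda>t. X t - A t" t0 "x0 - a t0"])
    show "\<not> collinear {0, B t - A t, C t - A t}" if "t \<in> T" for t
      using noncollinear[OF that] collinear_iff_diffs by blast
    show "congruent_pairs (x0 - a t0) (b t0 - a t0) (X t0 - A t0) (B t0 - A t0)"
        "congruent_pairs (x0 - a t0) (c t0 - a t0) (X t0 - A t0) (C t0 - A t0)"
      unfolding congruent_pairs_diff using start base t0 by (simp_all add: dist_commute)
  qed (use t0 in \<open>simp_all add: congruent_pairs_diff base cont continuous_on_diff\<close>)
  define x where "x t = a t + y t" for t
  have "y t = x t - a t" for t
    by (simp add: x_def)
  note dist_x = y(3,4)[unfolded this congruent_pairs_diff]
  show thesis
  proof
    show "continuous_on T x"
      unfolding x_def by (intro continuous_intros cont y(1))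
    show "x t0 = x0"
      by (simp add: x_def y(2))
  qed (use dist_x in \<open>auto simp: dist_commute\<close>)
qed

section \<open>Frameworks\<close>

definition edge_equivalent ::
    "'b set set \<Rightarrow> ('b \<Rightarrow> 'm::metric_space) \<Rightarrow> ('b \<Rightarrow> 'n::metric_space) \<Rightarrow> bool" where
  "edge_equivalent E p q \<longleftrightarrow> (\<forall>x y. {x, y} \<in> E \<longrightarrow> dist (p x) (p y) = dist (q x) (q y))"

lemma edge_equivalent_empty: "edge_equivalent {} p q"
  by (simp add: edge_equivalent_def)

lemma edge_equivalent_insert_edge:
  "edge_equivalent (insert {a, b} E) p q \<longleftrightarrow>
    dist (p a) (p b) = dist (q a) (q b) \<and> edge_equivalent E p q"
  by (auto simp: edge_equivalent_def doubleton_eq_iff dist_commute)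

lemma edge_equivalent_Un:
  "edge_equivalent (E \<union> E') p q \<longleftrightarrow> edge_equivalent E p q \<and> edge_equivalent E' p q"
  by (auto simp: edge_equivalent_def)

lemma edge_equivalent_subset: "edge_equivalent E p q \<Longrightarrow> E' \<subseteq> E \<Longrightarrow> edge_equivalent E' p q"
  unfolding edge_equivalent_def by blast

lemma edge_equivalent_agree:
  assumes "\<Union>E \<subseteq> V" "\<And>x. x \<in> V \<Longrightarrow> p x = p' x" "\<And>x. x \<in> V \<Longrightarrow> q x = q' x"
  shows "edge_equivalent E p q \<longleftrightarrow> edge_equivalent E p' q'"
proof -
  have "x \<in> V" "y \<in> V" if "{x, y} \<in> E" for x y
    using that assms(1) by auto
  then show ?thesis
    unfolding edge_equivalent_def using assms(2,3) by metis
qed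

lemma edge_equivalent_image:
  assumes inj: "inj_on f V" and E: "\<Union>E \<subseteq> V"
    and p: "\<And>x. x \<in> V \<Longrightarrow> p (f x) = p' x" and q: "\<And>x. x \<in> V \<Longrightarrow> q (f x) = q' x"
  shows "edge_equivalent ((`) f ` E) p q \<longleftrightarrow> edge_equivalent E p' q'"
proof
  have in_V: "x \<in> V" "y \<in> V" if "{x, y} \<in> E" for x y
    using that E by auto
  show "edge_equivalent E p' q'" if "edge_equivalent ((`) f ` E) p q"
    unfolding edge_equivalent_def
  proof (intro allI impI)
    fix x y assume xy: "{x, y} \<in> E"
    then have "{f x, f y} \<in> (`) f ` E"
      by (auto intro: image_eqI[of _ _ "{x, y}"])
    then have "dist (p (f x)) (p (f y)) = dist (q (f x)) (q (f y))"
      using that by (simp add: edge_equivalent_def)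
    then show "dist (p' x) (p' y) = dist (q' x) (q' y)"
      using in_V[OF xy] by (simp add: p q)
  qed
  show "edge_equivalent ((`) f ` E) p q" if equiv: "edge_equivalent E p' q'"
    unfolding edge_equivalent_def
  proof (intro allI impI)
    fix i j assume "{i, j} \<in> (`) f ` E"
    then obtain e where e: "e \<in> E" "f ` e = {i, j}"
      by auto
    then obtain x y where xy: "x \<in> e" "y \<in> e" "i = f x" "j = f y"
      by (metis imageE insertI1 insertI2)
    then have "f ` e = f ` {x, y}" "e \<subseteq> V" "{x, y} \<subseteq> V"
      using e E by auto
    then have "e = {x, y}"
      using inj_on_image_eq_iff[OF inj] by blast
    then show "dist (p i) (p j) = dist (q i) (q j)"
      using e(1) equiv xy(3,4) in_V[of x y] by (simp add: edge_equivalent_def p q)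
  qed
qed

definition edge_close :: "'b set set \<Rightarrow> real \<Rightarrow> ('b \<Rightarrow> 'm::metric_space) \<Rightarrow>
    ('b \<Rightarrow> 'n::metric_space) \<Rightarrow> bool" where
  "edge_close E \<epsilon> p q \<longleftrightarrow> (\<forall>x y. {x, y} \<in> E \<longrightarrow> \<bar>dist (p x) (p y) - dist (q x) (q y)\<bar> \<le> \<epsilon>)"

lemma edge_close_mono: "edge_close E \<epsilon> p q \<Longrightarrow> \<epsilon> \<le> \<epsilon>' \<Longrightarrow> edge_close E \<epsilon>' p q"
  unfolding edge_close_def by (meson order_trans)

lemma edge_close_subset: "edge_close E \<epsilon> p q \<Longrightarrow> E' \<subseteq> E \<Longrightarrow> edge_close E' \<epsilon> p q"
  unfolding edge_close_def by blast

lemma edge_equivalent_close_trans: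
  "edge_equivalent E p q \<Longrightarrow> edge_close E \<epsilon> q r \<Longrightarrow> edge_close E \<epsilon> p r"
  by (simp add: edge_close_def edge_equivalent_def)

lemma edge_close_equivalent_trans:
  "edge_close E \<epsilon> p q \<Longrightarrow> edge_equivalent E q r \<Longrightarrow> edge_close E \<epsilon> p r"
  by (simp add: edge_close_def edge_equivalent_def)

lemma edge_close_if_dist_le:
  assumes "\<And>x. dist (p x) (q x) \<le> \<epsilon> / 2"
  shows "edge_close E \<epsilon> p q"
  unfolding edge_close_def
proof (intro allI impI)
  show "\<bar>dist (p x) (p y) - dist (q x) (q y)\<bar> \<le> \<epsilon>" for x y
    using abs_dist_diff_le[of "p x" "p y" "q x"] abs_dist_diff_le[of "p y" "q x" "q y"]
      assms[of x] assms[of y] by linarith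
qed

lemma edge_equivalent_if_edge_close:
  assumes "\<And>n. edge_close E (inverse (Suc n)) p q"
  shows "edge_equivalent E p q"
  unfolding edge_equivalent_def
proof (intro allI impI)
  fix x y assume xy: "{x, y} \<in> E"
  have "\<bar>dist (p x) (p y) - dist (q x) (q y)\<bar> \<le> 0"
  proof (rule LIMSEQ_le_const[OF LIMSEQ_inverse_real_of_nat], intro exI allI impI)
    show "\<bar>dist (p x) (p y) - dist (q x) (q y)\<bar> \<le> inverse (Suc n)" for n
      using assms xy by (simp add: edge_close_def)
  qed
  then show "dist (p x) (p y) = dist (q x) (q y)"
    by simp
qed

lemma closed_edge_close: "closed {q :: 'b \<Rightarrow> 'm::metric_space. edge_close E \<epsilon> p q}"
  unfolding edge_close_def
  by (intro closed_Collect_all closed_Collect_imp open_Collect_const closed_Collect_le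
      continuous_intros continuous_on_product_coordinates)

lemma edge_length_le_diameter:
  assumes "finite V" "\<Union>E \<subseteq> V" "{x, y} \<in> E"
  shows "dist (p x) (p y) \<le> diameter (p ` V)"
  using assms by (intro diameter_bounded_bound finite_imp_bounded) auto

definition uniform_cball :: "('b \<Rightarrow> 'm::metric_space) \<Rightarrow> real \<Rightarrow> ('b \<Rightarrow> 'm) set" where
  "uniform_cball p M = {q. \<forall>x. dist (p x) (q x) \<le> M}"

lemma uniform_cball_eq_PiE: "uniform_cball p M = (\<Pi>\<^sub>E x\<in>UNIV. cball (p x) M)"
  by (auto simp: uniform_cball_def)

lemma uniform_cball_subset:
  assumes "\<And>x. dist (p x) (q x) \<le> d" "R + d \<le> M"
  shows "uniform_cball q R \<subseteq> uniform_cball p M"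
proof
  fix r assume r: "r \<in> uniform_cball q R"
  have "dist (p x) (r x) \<le> M" for x
  proof -
    have "dist (q x) (r x) \<le> R"
      using r by (simp add: uniform_cball_def)
    then show ?thesis
      using assms(1)[of x] assms(2) dist_triangle[of "p x" "r x" "q x"] by linarith
  qed
  then show "r \<in> uniform_cball p M"
    by (simp add: uniform_cball_def)
qed

lemma compact_uniform_cball: "compact (uniform_cball (p :: 'b \<Rightarrow> 'h::heine_borel) M)"
  unfolding uniform_cball_eq_PiE
  using compactin_PiE[of "\<lambda>_. euclidean" UNIV "\<lambda>x. cball (p x) M"]
  by (simp add: euclidean_product_topology)

lemma connected_uniform_cball: "connected (uniform_cball (p :: 'b \<Rightarrow> 'h::real_normed_vector) M)"
  unfolding uniform_cball_eq_PiE
  using connectedin_PiE[of "\<lambda>_. euclidean" UNIV "\<lambda>x. cball (p x) M"]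
  by (simp add: euclidean_product_topology convex_connected)

lemma connected_component_uniform_cball:
  fixes p q :: "'b \<Rightarrow> 'h::real_normed_vector"
  assumes "\<And>x. dist (p x) (q x) \<le> M"
  shows "connected_component (uniform_cball p M) p q"
  unfolding connected_component_def
proof (intro exI conjI)
  have "0 \<le> M"
    using assms zero_le_dist order_trans by blast
  then show "p \<in> uniform_cball p M" "q \<in> uniform_cball p M"
    using assms by (simp_all add: uniform_cball_def)
qed (auto simp: connected_uniform_cball)

section \<open>Lifting paths of configurations\<close>

text \<open>Fixing the image of one vertex excludes a drift by translations, hence makes lifts bounded.\<close>

definition anchored_lift :: "'t::t2_space set \<Rightarrow> 't \<Rightarrow> 'b set \<Rightarrow> 'b set set \<Rightarrow>
    ('t \<Rightarrow> 'b \<Rightarrow> 'h::metric_space) \<Rightarrow> ('b \<Rightarrow> 'g::metric_space) \<Rightarrow> ('t \<Rightarrow> 'b \<Rightarrow> 'g) \<Rightarrow> bool" where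
  "anchored_lift T t0 V E P p g \<longleftrightarrow> continuous_on T g \<and> g t0 = p \<and>
    (\<forall>t\<in>T. edge_equivalent E (P t) (g t)) \<and>
    (\<exists>a\<in>V. \<forall>t. g t a = p a) \<and> (\<forall>t. \<forall>x\<in>-V. g t x = p x)"

lemma continuous_on_fun_upd [continuous_intros]:
  fixes f :: "'t::t2_space \<Rightarrow> 'b \<Rightarrow> 'h::topological_space"
  assumes "continuous_on T f" "continuous_on T h"
  shows "continuous_on T (\<lambda>t. (f t)(v := h t))"
proof (rule continuous_on_coordinatewise_then_product)
  show "continuous_on T (\<lambda>t. ((f t)(v := h t)) x)" for x
    using assms continuous_on_product_then_coordinatewise[OF assms(1)] by (cases "x = v") simp_all
qed

lemma anchored_lift_triangle:
  fixes P :: "'t::t2_space \<Rightarrow> 'b \<Rightarrow> 'h::real_inner" and p :: "'b \<Rightarrow> 'g::real_inner"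
  assumes cont: "continuous_on T P"
    and noncollinear: "\<And>t. t \<in> T \<Longrightarrow> \<not> collinear {P t a, P t b, P t c}"
    and distinct: "distinct [a, b, c]" and t0: "t0 \<in> T"
    and start: "edge_equivalent {{a, b}, {a, c}, {b, c}} (P t0) p"
  obtains g where "anchored_lift T t0 {a, b, c} {{a, b}, {a, c}, {b, c}} P p g"
proof -
  have "continuous_on T (\<lambda>t. P t b - P t a)" "continuous_on T (\<lambda>t. P t c - P t a)"
    by (intro continuous_intros continuous_on_product_then_coordinatewise[OF cont])+
  moreover have "\<not> collinear {0, P t b - P t a, P t c - P t a}" if "t \<in> T" for t
    using noncollinear[OF that] collinear_iff_diffs by blast
  moreover have "congruent_pairs (p b - p a) (p c - p a) (P t0 b - P t0 a) (P t0 c - P t0 a)"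
    unfolding congruent_pairs_diff using start by (simp add: edge_equivalent_insert_edge)
  ultimately obtain u w where uw: "continuous_on T u" "continuous_on T w"
      "u t0 = p b - p a" "w t0 = p c - p a"
      "\<And>t. t \<in> T \<Longrightarrow> congruent_pairs (u t) (w t) (P t b - P t a) (P t c - P t a)"
    using congruent_pairs_path[OF _ _ _ t0] by blast
  define g where "g t = p(b := p a + u t, c := p a + w t)" for t
  have g: "g t a = p a" "g t b - g t a = u t" "g t c - g t a = w t" for t
    using distinct by (simp_all add: g_def)
  have "continuous_on T g"
    unfolding g_def by (intro continuous_intros uw(1,2))
  moreover have "g t0 = p"
    by (simp add: g_def uw(3,4) fun_upd_idem_iff)
  moreover have "edge_equivalent {{a, b}, {a, c}, {b, c}} (P t) (g t)" if "t \<in> T" for t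
    using uw(5)[OF that, folded g[of t], unfolded congruent_pairs_diff]
    by (simp add: edge_equivalent_insert_edge edge_equivalent_empty)
  ultimately show thesis
    using that[of g] g(1) by (simp add: anchored_lift_def g_def)
qed

lemma anchored_lift_insert:
  fixes P :: "'t::t2_space \<Rightarrow> 'b \<Rightarrow> 'h::real_inner" and p :: "'b \<Rightarrow> real^3"
  assumes g: "anchored_lift T t0 V E P p g" and cont: "continuous_on T P"
    and noncollinear: "\<And>t. t \<in> T \<Longrightarrow> \<not> collinear {P t a, P t b, P t c}"
    and t0: "t0 \<in> T" and start: "edge_equivalent {{v, a}, {v, b}, {v, c}} (P t0) p"
    and v: "\<Union>E \<subseteq> V" "v \<notin> V" and abc: "{a, b} \<in> E" "{a, c} \<in> E" "{b, c} \<in> E"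
  obtains g' where "anchored_lift T t0 (insert v V) (E \<union> {{v, a}, {v, b}, {v, c}}) P p g'"
proof -
  have cont_g: "continuous_on T g" and g0: "g t0 = p"
      and equiv: "\<And>t. t \<in> T \<Longrightarrow> edge_equivalent E (P t) (g t)"
      and outside: "\<And>t x. x \<notin> V \<Longrightarrow> g t x = p x"
    using g by (auto simp: anchored_lift_def)
  note coordinate = cont_g[THEN continuous_on_product_then_coordinatewise]
    cont[THEN continuous_on_product_then_coordinatewise]
  have base: "dist (g t x) (g t y) = dist (P t x) (P t y)" if "{x, y} \<in> E" "t \<in> T" for t x y
    using equiv that by (simp add: edge_equivalent_def)
  have start_v: "dist (p v) (g t0 y) = dist (P t0 v) (P t0 y)" if "y \<in> {a, b, c}" for y
    using start that by (auto simp: g0 edge_equivalent_insert_edge)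
  obtain x where x: "continuous_on T x" "x t0 = p v"
      "\<And>t. t \<in> T \<Longrightarrow> dist (x t) (g t a) = dist (P t v) (P t a)"
      "\<And>t. t \<in> T \<Longrightarrow> dist (x t) (g t b) = dist (P t v) (P t b)"
      "\<And>t. t \<in> T \<Longrightarrow> dist (x t) (g t c) = dist (P t v) (P t c)"
    by (rule attached_point_path[OF coordinate(1)[of a] coordinate(1)[of b] coordinate(1)[of c]
          coordinate(2)[of a] coordinate(2)[of b] coordinate(2)[of c] coordinate(2)[of v]
          noncollinear base[OF abc(1)] base[OF abc(2)] base[OF abc(3)] t0]) (use start_v in auto)
  define g' where "g' t = (g t)(v := x t)" for t
  have old: "g' t y = g t y" if "y \<in> V" for t y
    using that v(2) by (auto simp: g'_def)
  have "edge_equivalent {{v, a}, {v, b}, {v, c}} (P t) (g' t)" if "t \<in> T" for t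
    using x(3-5)[OF that] old[of _ t] abc v
    by (auto simp: edge_equivalent_insert_edge edge_equivalent_empty g'_def)
  moreover have "edge_equivalent E (P t) (g' t)" if "t \<in> T" for t
    using equiv[OF that] edge_equivalent_agree[OF v(1), of "P t" "P t" "g t" "g' t"] old by simp
  moreover have "continuous_on T g'" "g' t0 = p"
    unfolding g'_def by (intro continuous_intros cont_g x(1)) (simp add: x(2) g0)
  moreover have "\<exists>d\<in>insert v V. \<forall>t. g' t d = p d"
    using g old by (auto simp: anchored_lift_def)
  moreover have "\<forall>t. \<forall>y\<in>- insert v V. g' t y = p y"
    using outside by (simp add: g'_def)
  ultimately have "anchored_lift T t0 (insert v V) (E \<union> {{v, a}, {v, b}, {v, c}}) P p g'"
    unfolding anchored_lift_def edge_equivalent_Un by blast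
  then show thesis
    by (rule that)
qed

definition general_position :: "'b set \<Rightarrow> ('b \<Rightarrow> 'h::real_vector) \<Rightarrow> bool" where
  "general_position V p \<longleftrightarrow> inj_on p V \<and>
    (\<forall>a\<in>V. \<forall>b\<in>V. \<forall>c\<in>V. distinct [a, b, c] \<longrightarrow> \<not> collinear {p a, p b, p c})"

lemma general_position_subset: "general_position V p \<Longrightarrow> U \<subseteq> V \<Longrightarrow> general_position U p"
  unfolding general_position_def by (meson inj_on_subset subsetD)

lemma three_tree_edge_subset: "three_tree V E \<Longrightarrow> \<Union>E \<subseteq> V"
  by (induction rule: three_tree.induct) auto

lemma three_tree_finite: "three_tree V E \<Longrightarrow> finite V"
  by (induction rule: three_tree.induct) (auto intro: card_ge_0_finite)

lemma three_tree_dist_le: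
  fixes r :: "nat \<Rightarrow> 'm::metric_space" and D :: real
  assumes "three_tree V E" "0 \<le> D" "\<And>x y. {x, y} \<in> E \<Longrightarrow> dist (r x) (r y) \<le> D" "x \<in> V" "y \<in> V"
  shows "dist (r x) (r y) \<le> card V * D"
  using assms
proof (induction arbitrary: x y rule: three_tree.induct)
  case (K4 V E)
  have "dist (r x) (r y) \<le> D"
    using K4 by (cases "x = y") auto
  then show ?case
    using K4(1,3) by simp
next
  case (add V E a b c v)
  have card: "card (insert v V) = Suc (card V)"
    using add.hyps three_tree_finite by auto
  have old: "dist (r x) (r y) \<le> card V * D" if "x \<in> V" "y \<in> V" for x y
    using add.IH add.prems(1,2) that by blast
  have "dist (r v) (r a) \<le> D"
    using add.prems(2) by blast
  then have new: "dist (r v) (r y) \<le> Suc (card V) * D" if "y \<in> V" for y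
    using dist_triangle[of "r v" "r y" "r a"] old[OF \<open>a \<in> V\<close> that] by (simp add: distrib_right)
  have "0 \<le> card V * D"
    using add.prems(1) by simp
  then show ?case
    unfolding card using add.prems(1,3,4) old[of x y] new[of x] new[of y]
    by (auto simp: dist_commute distrib_right)
qed

lemma edges_insert_triple:
  assumes "distinct [a, b, c]" "d \<notin> {a, b, c}"
  shows "{e. e \<subseteq> insert d {a, b, c} \<and> card e = 2} =
    {{a, b}, {a, c}, {b, c}} \<union> {{d, a}, {d, b}, {d, c}}" (is "?L = ?R")
proof
  show "?L \<subseteq> ?R"
  proof
    fix e assume e: "e \<in> ?L"
    then obtain x y where "e = {x, y}" "x \<noteq> y"
      by (auto simp: card_2_iff)
    moreover from this e have "x \<in> {d, a, b, c}" "y \<in> {d, a, b, c}"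
      by simp_all
    ultimately show "e \<in> ?R"
      by (elim insertE) (simp_all add: doubleton_eq_iff)
  qed
qed (use assms in auto)

lemma three_tree_anchored_lift:
  fixes P :: "'t::t2_space \<Rightarrow> nat \<Rightarrow> 'h::real_inner" and p :: "nat \<Rightarrow> real^3"
  assumes "three_tree V E" and cont: "continuous_on T P" and t0: "t0 \<in> T"
    and "\<And>t. t \<in> T \<Longrightarrow> general_position V (P t)" and "edge_equivalent E (P t0) p"
  shows "\<exists>g. anchored_lift T t0 V E P p g"
  using assms(1,4,5)
proof (induction rule: three_tree.induct)
  case (K4 V E)
  obtain d V3 where "V = insert d V3" "d \<notin> V3" "card V3 = 3"
    using K4(1) card_eq_SucD[of V 3] by auto
  moreover then obtain a b c where "V3 = {a, b, c}" "a \<noteq> b" "b \<noteq> c" "a \<noteq> c"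
    by (metis card_3_iff)
  ultimately have V: "V = insert d {a, b, c}" and dist: "distinct [a, b, c]" "d \<notin> {a, b, c}"
    by auto
  have E: "E = {{a, b}, {a, c}, {b, c}} \<union> {{d, a}, {d, b}, {d, c}}"
    unfolding K4(2) V by (rule edges_insert_triple[OF dist])
  have noncollinear: "\<not> collinear {P t a, P t b, P t c}" if "t \<in> T" for t
    using K4(3)[OF that] dist by (simp add: general_position_def V)
  note start = K4(4)[unfolded E edge_equivalent_Un]
  obtain g where g: "anchored_lift T t0 {a, b, c} {{a, b}, {a, c}, {b, c}} P p g"
    using anchored_lift_triangle[OF cont noncollinear dist(1) t0] start by blast
  obtain g' where "anchored_lift T t0 V E P p g'"
    unfolding E V
    by (rule anchored_lift_insert[OF g cont noncollinear t0 _ _ dist(2)]) (use start in auto)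
  then show ?case
    by blast
next
  case (add V E a b c v)
  have "general_position V (P t)" if "t \<in> T" for t
    using add.prems(1)[OF that] general_position_subset by blast
  then obtain g where g: "anchored_lift T t0 V E P p g"
    using add.IH add.prems(2) unfolding edge_equivalent_Un by blast
  have "\<not> collinear {P t a, P t b, P t c}" if "t \<in> T" for t
    using add.prems(1)[OF that] add.hyps by (simp add: general_position_def)
  then show ?case
    using add.prems(2) anchored_lift_insert[OF g cont _ t0 _
        three_tree_edge_subset[OF add.hyps(1)] add.hyps(11,8,10,9)]
    unfolding edge_equivalent_Un by metis
qed

lemma anchored_lift_uniform_cball:
  fixes D :: real
  assumes tree: "three_tree V E" and lift: "anchored_lift T t0 V E P p g"
    and D: "0 \<le> D" "\<And>t x y. t \<in> T \<Longrightarrow> {x, y} \<in> E \<Longrightarrow> dist (P t x) (P t y) \<le> D"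
    and t0: "t0 \<in> T" and t: "t \<in> T"
  shows "g t \<in> uniform_cball p (2 * card V * D)"
proof -
  obtain a where a: "a \<in> V" "\<And>t. g t a = p a" and g0: "g t0 = p"
    using lift by (auto simp: anchored_lift_def)
  have "dist (p x) (g t x) \<le> 2 * card V * D" for x
  proof (cases "x \<in> V")
    case True
    have "dist (g s x) (p a) \<le> card V * D" if "s \<in> T" for s
    proof -
      have "dist (g s x) (g s a) \<le> card V * D"
        using lift D that a(1) True
        by (intro three_tree_dist_le[OF tree]) (auto simp: anchored_lift_def edge_equivalent_def)
      then show ?thesis
        by (simp add: a(2))
    qed
    from this[OF t] this[OF t0] show ?thesis
      using dist_triangle2[of "p x" "g t x" "p a"] by (simp add: g0)
  next
    case False
    then show ?thesis
      using lift D(1) by (simp add: anchored_lift_def)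
  qed
  then show ?thesis
    by (simp add: uniform_cball_def)
qed

section \<open>General position and interpolation\<close>

lemma collinear_linear_image:
  assumes "linear h" "collinear S"
  shows "collinear (h ` S)"
proof -
  obtain u where "\<And>x y. x \<in> S \<Longrightarrow> y \<in> S \<Longrightarrow> \<exists>c. x - y = c *\<^sub>R u"
    using assms(2) unfolding collinear_def by blast
  then have "\<exists>c. h x - h y = c *\<^sub>R h u" if "x \<in> S" "y \<in> S" for x y
    using that assms(1) by (metis linear_diff linear_scale)
  then show ?thesis
    unfolding collinear_def by blast
qed

lemma general_position_if_linear_image:
  assumes "linear h" "general_position V (h \<circ> p)"
  shows "general_position V p"
  unfolding general_position_def
proof (intro conjI ballI impI notI)
  show "inj_on p V"
    using assms(2) by (auto simp: general_position_def intro: inj_on_imageI2)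
  fix a b c assume abc: "a \<in> V" "b \<in> V" "c \<in> V" "distinct [a, b, c]" "collinear {p a, p b, p c}"
  then have "collinear {h (p a), h (p b), h (p c)}"
    using collinear_linear_image[OF assms(1), of "{p a, p b, p c}"] by simp
  then show False
    using assms(2) abc by (simp add: general_position_def)
qed

lemma general_position_insert:
  fixes p :: "'b \<Rightarrow> 'h::euclidean_space"
  assumes p: "general_position V p" and v: "v \<notin> V"
    and z: "\<And>x y. x \<in> V \<Longrightarrow> y \<in> V \<Longrightarrow> z \<notin> affine hull {p x, p y}"
  shows "general_position (insert v V) (p(v := z))"
proof -
  have "z \<noteq> p x" if "x \<in> V" for x
    using z[OF that that] by auto
  then have "inj_on (p(v := z)) (insert v V)"
    using p v by (auto simp: general_position_def inj_on_def)
  moreover have new: "\<not> collinear {p x, p y, z}" if "x \<in> V" "y \<in> V" "x \<noteq> y" for x y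
  proof -
    have "p x \<noteq> p y"
      using p that by (auto simp: general_position_def dest: inj_onD)
    then show ?thesis
      using z[OF that(1,2)] by (simp add: collinear_3_affine_hull)
  qed
  moreover have "\<not> collinear {p x, z, p y}" "\<not> collinear {z, p x, p y}"
    if "x \<in> V" "y \<in> V" "x \<noteq> y" for x y
    using new[OF that] by (simp_all add: insert_commute)
  ultimately show ?thesis
    using p v by (auto simp: general_position_def)
qed

lemma negligible_affine_hull_2:
  fixes x y :: "'h::euclidean_space"
  assumes "2 \<le> DIM('h)"
  shows "negligible (affine hull {x, y})"
proof -
  have "card {x, y} \<le> DIM('h)"
    using assms by (simp add: card_insert_if)
  then show ?thesis
    by (simp add: negligible_convex_interior affine_imp_convex empty_interior_affine_hull)
qed

lemma general_position_dense:
  fixes p :: "'b \<Rightarrow> 'h::euclidean_space"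
  assumes "finite V" "2 \<le> DIM('h)" "0 < e"
  shows "\<exists>p'. general_position V p' \<and> (\<forall>x. dist (p x) (p' x) < e)"
  using assms(1)
proof (induction rule: finite_induct)
  case empty
  then show ?case
    using assms(3) by (intro exI[of _ p]) (simp add: general_position_def)
next
  case (insert v V)
  then obtain p' where p': "general_position V p'" "\<And>x. dist (p x) (p' x) < e"
    by blast
  have "negligible (\<Union>x\<in>V. \<Union>y\<in>V. affine hull {p' x, p' y})"
    using insert.hyps(1) assms(2) by (auto intro!: negligible_Union negligible_affine_hull_2)
  moreover have "\<not> negligible (ball (p v) e)"
    using assms(3) by (simp add: open_not_negligible)
  ultimately obtain z where z: "z \<in> ball (p v) e"
      "z \<notin> (\<Union>x\<in>V. \<Union>y\<in>V. affine hull {p' x, p' y})"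
    by (meson negligible_subset subsetI)
  then have "general_position (insert v V) (p'(v := z))"
    by (intro general_position_insert p' insert.hyps) auto
  moreover have "dist (p x) ((p'(v := z)) x) < e" for x
    using p'(2) z(1) by simp
  ultimately show ?case
    by blast
qed

definition interpolate :: "('b \<Rightarrow> 'g) \<Rightarrow> ('b \<Rightarrow> 'h) \<Rightarrow> real \<Rightarrow> 'b \<Rightarrow>
    'g::real_normed_vector \<times> 'h::real_normed_vector" where
  "interpolate p q t x = (sqrt (1 - t) *\<^sub>R p x, sqrt t *\<^sub>R q x)"

lemma continuous_on_interpolate: "continuous_on T (interpolate p q)"
  by (rule continuous_on_coordinatewise_then_product)
    (unfold interpolate_def, intro continuous_intros)

lemma general_position_interpolate:
  assumes t: "t \<in> {0..1}" and p: "general_position V p" and q: "general_position V q"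
  shows "general_position V (interpolate p q t)"
proof (cases "t = 0")
  case True
  have "linear (fst :: 'b \<times> 'c \<Rightarrow> 'b)"
    by (rule linear_fst)
  moreover have "fst \<circ> interpolate p q t = p"
    using True by (simp add: fun_eq_iff interpolate_def)
  ultimately show ?thesis
    using general_position_if_linear_image p by metis
next
  case False
  have "linear (\<lambda>z :: 'b \<times> 'c. (1 / sqrt t) *\<^sub>R snd z)"
    by (intro linear_compose_scale_right linear_snd)
  moreover have "(\<lambda>z. (1 / sqrt t) *\<^sub>R snd z) \<circ> interpolate p q t = q"
    using False t by (simp add: fun_eq_iff interpolate_def)
  ultimately show ?thesis
    using general_position_if_linear_image q by metis
qed

lemma dist_interpolate:
  assumes "t \<in> {0..1}"
  shows "(dist (interpolate p q t x) (interpolate p q t y))\<^sup>2 =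
    (1 - t) * (dist (p x) (p y))\<^sup>2 + t * (dist (q x) (q y))\<^sup>2"
  using assms
  by (simp add: interpolate_def dist_norm norm_Pair power_mult_distrib flip: scaleR_diff_right)

lemma dist_interpolate_bounds:
  fixes lo hi :: real
  assumes t: "t \<in> {0..1}" and p: "dist (p x) (p y) \<in> {lo..hi}" and q: "dist (q x) (q y) \<in> {lo..hi}"
  shows "dist (interpolate p q t x) (interpolate p q t y) \<in> {lo..hi}"
proof -
  let ?d = "dist (interpolate p q t x) (interpolate p q t y)"
  have hi: "0 \<le> hi"
    using p zero_le_dist[of "p x" "p y"] by (simp del: zero_le_dist)
  have "?d\<^sup>2 \<le> hi\<^sup>2"
    unfolding dist_interpolate[OF t] using t p q by (intro convex_bound_le power_mono) auto
  moreover have "(max lo 0)\<^sup>2 \<le> ?d\<^sup>2"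
  proof -
    have "(max lo 0)\<^sup>2 = (1 - t) * (max lo 0)\<^sup>2 + t * (max lo 0)\<^sup>2"
      by (simp add: algebra_simps)
    also have "\<dots> \<le> ?d\<^sup>2"
      unfolding dist_interpolate[OF t] using t p q
      by (intro add_mono mult_left_mono power_mono) auto
    finally show ?thesis .
  qed
  ultimately show ?thesis
    using power2_le_imp_le[of ?d hi] power2_le_imp_le[of "max lo 0" ?d] hi by simp
qed

lemma edge_close_interpolate:
  assumes "t \<in> {0..1}" "edge_close E \<epsilon> r p" "edge_close E \<epsilon> r q"
  shows "edge_close E \<epsilon> r (interpolate p q t)"
  unfolding edge_close_def
proof (intro allI impI)
  fix x y assume "{x, y} \<in> E"
  then have "\<bar>dist (r x) (r y) - dist (p x) (p y)\<bar> \<le> \<epsilon>" "\<bar>dist (r x) (r y) - dist (q x) (q y)\<bar> \<le> \<epsilon>"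
    using assms(2,3) by (simp_all add: edge_close_def)
  then have "dist (p x) (p y) \<in> {dist (r x) (r y) - \<epsilon>..dist (r x) (r y) + \<epsilon>}"
      "dist (q x) (q y) \<in> {dist (r x) (r y) - \<epsilon>..dist (r x) (r y) + \<epsilon>}"
    by (simp_all add: abs_le_iff algebra_simps)
  from dist_interpolate_bounds[OF assms(1) this]
  show "\<bar>dist (r x) (r y) - dist (interpolate p q t x) (interpolate p q t y)\<bar> \<le> \<epsilon>"
    by (auto simp: abs_le_iff)
qed

section \<open>Components\<close>

lemma compact_decseq_Inter_nonempty:
  fixes C :: "nat \<Rightarrow> 'b::t2_space set"
  assumes "\<And>n. compact (C n)" "\<And>n. C n \<noteq> {}" "decseq C"
  shows "(\<Inter>n. C n) \<noteq> {}"
proof (rule compact_space_imp_nest[of "top_of_set (C 0)"])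
  show "compact_space (top_of_set (C 0))"
    using assms(1) by (simp add: compact_space_subtopology)
  show "closedin (top_of_set (C 0)) (C n)" for n
    using assms(1,3) by (intro closed_subset compact_imp_closed) (auto simp: decseq_def)
qed (use assms in auto)

lemma connected_decseq_Inter:
  fixes C :: "nat \<Rightarrow> 'b::t4_space set"
  assumes compact: "\<And>n. compact (C n)" and connected: "\<And>n. connected (C n)" and dec: "decseq C"
  shows "connected (\<Inter>n. C n)"
proof (rule ccontr)
  have closed: "closed (\<Inter>n. C n)"
    using compact by (intro closed_INT) (simp add: compact_imp_closed)
  assume "\<not> connected (\<Inter>n. C n)"
  then obtain A B where AB: "closed A" "closed B" "A \<noteq> {}" "B \<noteq> {}"
      "A \<union> B = (\<Inter>n. C n)" "A \<inter> B = {}"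
    using connected_closed_set[OF closed] by auto
  then obtain U W where UW: "open U" "open W" "A \<subseteq> U" "B \<subseteq> W" "U \<inter> W = {}"
    using t4_space[of A B] by auto
  have "(\<Inter>n. C n - (U \<union> W)) \<noteq> {}"
  proof (rule compact_decseq_Inter_nonempty)
    show "compact (C n - (U \<union> W))" for n
      using compact UW(1,2) by (intro compact_diff) auto
    show "C n - (U \<union> W) \<noteq> {}" for n
    proof -
      have "U \<inter> C n \<noteq> {}" "W \<inter> C n \<noteq> {}"
        using UW(3,4) AB(3-5) by blast+
      moreover have "U \<inter> W \<inter> C n = {}"
        using UW(5) by simp
      ultimately show ?thesis
        using connectedD[OF connected[of n] UW(1,2)] by blast
    qed
    show "decseq (\<lambda>n. C n - (U \<union> W))"
      using dec by (auto simp: decseq_def)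
  qed
  then show False
    using AB(5) UW(3,4) by blast
qed

lemma connected_component_decseq_Inter:
  fixes K Q :: "nat \<Rightarrow> 'b::t4_space set"
  assumes K: "\<And>n. compact (K n)" "decseq K" and Q: "\<And>n. closed (Q n)" "decseq Q"
    and reaches: "\<And>n. \<exists>b\<in>Q n. connected_component (K n) a b"
  shows "\<exists>b\<in>\<Inter>n. Q n. connected_component (\<Inter>n. K n) a b"
proof -
  define A where "A n = connected_component_set (K n) a" for n
  have compact: "compact (A n)" for n
    unfolding A_def using K(1) closedin_connected_component by (rule closedin_compact)
  have dec: "decseq A"
    using K(2) unfolding A_def decseq_def by (blast intro: connected_component_of_subset)
  have "(\<Inter>n. A n \<inter> Q n) \<noteq> {}"
  proof (rule compact_decseq_Inter_nonempty)
    show "compact (A n \<inter> Q n)" for n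
      using compact Q(1) by (rule compact_Int_closed)
    show "A n \<inter> Q n \<noteq> {}" for n
      using reaches[of n] by (auto simp: A_def)
    show "decseq (\<lambda>n. A n \<inter> Q n)"
      using dec Q(2) unfolding decseq_def by blast
  qed
  then obtain b where b: "\<And>n. b \<in> A n" "\<And>n. b \<in> Q n"
    by blast
  have "connected (A n)" for n
    by (simp add: A_def)
  then have "connected (\<Inter>n. A n)"
    using compact dec by (intro connected_decseq_Inter)
  moreover have "a \<in> (\<Inter>n. A n)"
    using b(1) by (auto simp: A_def dest: connected_component_in)
  moreover have "(\<Inter>n. A n) \<subseteq> (\<Inter>n. K n)"
    unfolding A_def using connected_component_subset by blast
  ultimately have "connected_component (\<Inter>n. K n) a b"
    using b(1) unfolding connected_component_def by blast
  then show ?thesis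
    using b(2) by blast
qed

lemma connected_component_continuous_image:
  assumes "continuous_on S h" "h ` S \<subseteq> T" "connected_component S a b"
  shows "connected_component T (h a) (h b)"
proof -
  obtain C where C: "connected C" "C \<subseteq> S" "a \<in> C" "b \<in> C"
    using assms(3) unfolding connected_component_def by blast
  have "connected (h ` C)"
    using continuous_on_subset[OF assms(1) C(2)] C(1) by (rule connected_continuous_image)
  then show ?thesis
    unfolding connected_component_def using C(2-4) assms(2) by (intro exI[of _ "h ` C"]) blast
qed

lemma general_position_component_reaches:
  fixes p q :: "nat \<Rightarrow> real^3" and D :: real
  assumes tree: "three_tree V E" and sub: "E' \<subseteq> E"
    and gp: "general_position V p" "general_position V q"
    and close: "edge_close E' \<epsilon> s p" "edge_close E' \<epsilon> s q"
    and D: "0 \<le> D" "\<And>x y. {x, y} \<in> E \<Longrightarrow> dist (p x) (p y) \<le> D"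
      "\<And>x y. {x, y} \<in> E \<Longrightarrow> dist (q x) (q y) \<le> D"
  obtains r where "edge_equivalent E q r"
    "connected_component (uniform_cball p (2 * card V * D) \<inter> {r. edge_close E' \<epsilon> s r}) p r"
proof -
  let ?K = "uniform_cball p (2 * card V * D) \<inter> {r. edge_close E' \<epsilon> s r}"
  let ?P = "interpolate p q"
  have ends: "edge_equivalent E (?P 0) p" "edge_equivalent E q (?P 1)"
    by (simp_all add: edge_equivalent_def interpolate_def dist_Pair_Pair)
  have "\<exists>g. anchored_lift {0..1} 0 V E ?P p g"
    using ends(1) gp
    by (intro three_tree_anchored_lift[OF tree continuous_on_interpolate])
      (auto intro: general_position_interpolate)
  then obtain g where g: "anchored_lift {0..1} 0 V E ?P p g"
    by blast
  then have lengths: "edge_equivalent E (?P t) (g t)" if "t \<in> {0..1}" for t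
    using that by (simp add: anchored_lift_def)
  have "dist (?P t x) (?P t y) \<le> D" if "t \<in> {0..1}" "{x, y} \<in> E" for t x y
    using dist_interpolate_bounds[OF that(1), of p x y 0 D q] D(2,3)[OF that(2)] by simp
  then have "g t \<in> uniform_cball p (2 * card V * D)" if "t \<in> {0..1}" for t
    using D(1) that by (intro anchored_lift_uniform_cball[OF tree g]) auto
  moreover have "edge_close E' \<epsilon> s (g t)" if "t \<in> {0..1}" for t
    using edge_close_interpolate[OF that close] edge_equivalent_subset[OF lengths[OF that] sub]
    by (rule edge_close_equivalent_trans)
  ultimately have "g ` {0..1} \<subseteq> ?K"
    by blast
  moreover have "connected (g ` {0..1})" "g 0 = p"
    using g by (auto simp: anchored_lift_def intro: connected_continuous_image)
  ultimately have "connected_component ?K p (g 1)"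
    unfolding connected_component_def by (intro exI[of _ "g ` {0..1}"]) force
  moreover have "edge_equivalent E q (g 1)"
    using ends(2) lengths[of 1] by (simp add: edge_equivalent_def)
  ultimately show thesis
    using that by blast
qed

lemma three_tree_component_nearly_reaches:
  fixes p q :: "nat \<Rightarrow> real^3" and D :: real
  assumes tree: "three_tree V E" and sub: "E' \<subseteq> E" and pq: "edge_equivalent E' p q"
    and \<epsilon>: "0 < \<epsilon>" "\<epsilon> \<le> 1"
    and D: "0 \<le> D" "\<And>x y. {x, y} \<in> E \<Longrightarrow> dist (p x) (p y) \<le> D"
      "\<And>x y. {x, y} \<in> E \<Longrightarrow> dist (q x) (q y) \<le> D"
  defines "K \<equiv> uniform_cball p (2 * card V * (D + 1) + 1) \<inter> {r. edge_close E' \<epsilon> p r}"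
  shows "\<exists>r. edge_close E \<epsilon> q r \<and> connected_component K p r"
proof -
  have "0 < \<epsilon> / 2" "2 \<le> DIM(real^3)"
    using \<epsilon> by simp_all
  then obtain p' q' where gp: "general_position V p'" "general_position V q'"
      and near: "\<And>x. dist (p x) (p' x) < \<epsilon> / 2" "\<And>x. dist (q x) (q' x) < \<epsilon> / 2"
    using general_position_dense[OF three_tree_finite[OF tree]] by metis
  have pp': "edge_close E \<epsilon> p p'" and qq': "edge_close E \<epsilon> q q'"
    using near by (simp_all add: edge_close_if_dist_le less_imp_le)
  have close: "edge_close E' \<epsilon> p p'" "edge_close E' \<epsilon> p q'"
    using edge_close_subset[OF pp' sub]
      edge_equivalent_close_trans[OF pq edge_close_subset[OF qq' sub]] by auto
  have D': "0 \<le> D + 1" "\<And>x y. {x, y} \<in> E \<Longrightarrow> dist (p' x) (p' y) \<le> D + 1"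
      "\<And>x y. {x, y} \<in> E \<Longrightarrow> dist (q' x) (q' y) \<le> D + 1"
    using pp' qq' D \<epsilon>(2) unfolding edge_close_def by (force simp: abs_le_iff)+
  from general_position_component_reaches[OF tree sub gp close D'] obtain r
    where r: "edge_equivalent E q' r"
      "connected_component
        (uniform_cball p' (2 * card V * (D + 1)) \<inter> {r. edge_close E' \<epsilon> p r}) p' r" .
  have "uniform_cball p' (2 * card V * (D + 1)) \<subseteq> uniform_cball p (2 * card V * (D + 1) + 1)"
    using near(1) \<epsilon> by (intro uniform_cball_subset[where d = "\<epsilon> / 2"]) (auto intro: less_imp_le)
  then have "connected_component K p' r"
    unfolding K_def by (intro connected_component_of_subset[OF r(2)]) blast
  moreover have "uniform_cball p (\<epsilon> / 2) \<subseteq> uniform_cball p (2 * card V * (D + 1) + 1)"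
    using D(1) \<epsilon>(2) by (intro uniform_cball_subset[where d = 0]) (auto intro: add_increasing)
  then have "uniform_cball p (\<epsilon> / 2) \<subseteq> K"
    by (auto simp: K_def uniform_cball_def[of p "\<epsilon> / 2"] simp del: le_divide_eq_numeral1
        intro: edge_close_if_dist_le)
  then have "connected_component K p p'"
    using near(1) connected_component_uniform_cball[of p p' "\<epsilon> / 2"]
    by (meson connected_component_of_subset less_imp_le)
  ultimately have "connected_component K p r"
    using connected_component_trans by blast
  then show ?thesis
    using edge_close_equivalent_trans[OF qq' r(1)] by blast
qed

lemma three_tree_component_reaches:
  fixes p q :: "nat \<Rightarrow> real^3"
  assumes tree: "three_tree V E" and sub: "E' \<subseteq> E" and pq: "edge_equivalent E' p q"
  obtains r where "edge_equivalent E q r" "connected_component {r. edge_equivalent E' p r} p r"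
proof -
  define D where "D = max (diameter (p ` V)) (diameter (q ` V))"
  have D: "0 \<le> D" "\<And>x y. {x, y} \<in> E \<Longrightarrow> dist (p x) (p y) \<le> D"
      "\<And>x y. {x, y} \<in> E \<Longrightarrow> dist (q x) (q y) \<le> D"
    using edge_length_le_diameter[OF three_tree_finite[OF tree] three_tree_edge_subset[OF tree]]
      three_tree_finite[OF tree]
    by (auto simp: D_def le_max_iff_disj finite_imp_bounded intro: diameter_ge_0)
  define K where "K n = uniform_cball p (2 * card V * (D + 1) + 1) \<inter>
    {r. edge_close E' (inverse (Suc n)) p r}" for n
  define Q where "Q n = {r :: nat \<Rightarrow> real^3. edge_close E (inverse (Suc n)) q r}" for n
  have shrink: "inverse (real (Suc n)) \<le> inverse (real (Suc m))" if "m \<le> n" for m n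
    using that by (simp add: field_simps)
  have "\<exists>r\<in>\<Inter>n. Q n. connected_component (\<Inter>n. K n) p r"
  proof (rule connected_component_decseq_Inter)
    show "compact (K n)" for n
      unfolding K_def by (intro compact_Int_closed compact_uniform_cball closed_edge_close)
    show "closed (Q n)" for n
      unfolding Q_def by (rule closed_edge_close)
    show "decseq K" "decseq Q"
      using shrink by (auto simp: K_def Q_def decseq_def intro: edge_close_mono)
    show "\<exists>r\<in>Q n. connected_component (K n) p r" for n
      using three_tree_component_nearly_reaches[OF tree sub pq _ _ D, of "inverse (Suc n)"]
      by (auto simp: K_def Q_def field_simps)
  qed
  then obtain r where r: "\<And>n. r \<in> Q n" "connected_component (\<Inter>n. K n) p r"
    by blast
  show thesis
  proof
    show "edge_equivalent E q r"
      using r(1) by (intro edge_equivalent_if_edge_close) (simp add: Q_def)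
    have "(\<Inter>n. K n) \<subseteq> {r. edge_equivalent E' p r}"
      by (auto simp: K_def intro!: edge_equivalent_if_edge_close)
    then show "connected_component {r. edge_equivalent E' p r} p r"
      using connected_component_of_subset[OF r(2)] by blast
  qed
qed

lemma continuous_on_reindex:
  "continuous_on S (\<lambda>(s :: 'b \<Rightarrow> 'h::topological_space) x. if x \<in> V then s (f x) else c)"
proof (rule continuous_on_coordinatewise_then_product)
  show "continuous_on S (\<lambda>s :: 'b \<Rightarrow> 'h. if x \<in> V then s (f x) else c)" for x
    by (cases "x \<in> V") (auto intro: continuous_on_subset[OF continuous_on_product_coordinates])
qed

lemma partial_three_tree_component_reaches:
  fixes p q :: "'a \<Rightarrow> real^3"
  assumes "partial_three_tree V H" and HV: "\<Union>H \<subseteq> V" and sub: "E \<subseteq> H"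
    and pq: "edge_equivalent E p q" and p0: "\<And>x. x \<notin> V \<Longrightarrow> p x = 0"
  obtains r where "edge_equivalent H q r"
    "connected_component {r. (\<forall>x. x \<notin> V \<longrightarrow> r x = 0) \<and> edge_equivalent E p r} p r"
proof -
  obtain TV TE f where tree: "three_tree TV TE" and inj: "inj_on f V" and edges: "(`) f ` H \<subseteq> TE"
    using assms(1) unfolding partial_three_tree_def by blast
  define push where "push s = s \<circ> the_inv_into V f" for s :: "'a \<Rightarrow> real^3"
  define pull where "pull s x = (if x \<in> V then s (f x) else 0)" for s :: "nat \<Rightarrow> real^3" and x
  have push: "push s (f x) = s x" if "x \<in> V" for s x
    using that inj by (simp add: push_def the_inv_into_f_f)
  have pull: "s (f x) = pull s x" if "x \<in> V" for s x
    using that by (simp add: pull_def)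
  have EV: "\<Union>E \<subseteq> V" and edges_E: "(`) f ` E \<subseteq> TE"
    using HV sub edges by blast+
  have "edge_equivalent ((`) f ` E) (push p) (push q)"
    using pq push edge_equivalent_image[OF inj EV, of "push p" p "push q" q] by simp
  then obtain r where r: "edge_equivalent TE (push q) r"
      "connected_component {r. edge_equivalent ((`) f ` E) (push p) r} (push p) r"
    using three_tree_component_reaches[OF tree edges_E] by metis
  have "edge_equivalent E p (pull s)" if "edge_equivalent ((`) f ` E) (push p) s" for s
    using that push pull edge_equivalent_image[OF inj EV, of "push p" p s "pull s"] by simp
  then have "pull ` {s. edge_equivalent ((`) f ` E) (push p) s} \<subseteq>
      {r. (\<forall>x. x \<notin> V \<longrightarrow> r x = 0) \<and> edge_equivalent E p r}"
    by (auto simp: pull_def)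
  moreover have "continuous_on S pull" for S
    using continuous_on_reindex[of S V f 0] by (simp add: pull_def[abs_def])
  ultimately have "connected_component {r. (\<forall>x. x \<notin> V \<longrightarrow> r x = 0) \<and> edge_equivalent E p r}
      (pull (push p)) (pull r)"
    using connected_component_continuous_image r(2) by blast
  moreover have "pull (push p) = p"
    using p0 push by (auto simp: pull_def)
  moreover have "edge_equivalent H q (pull r)"
    using edge_equivalent_subset[OF r(1) edges] push pull
      edge_equivalent_image[OF inj HV, of "push q" q r "pull r"] by simp
  ultimately show thesis
    using that by simp
qed

lemma config3_eq_edge_equivalent:
  assumes "p \<in> config3 V E l"
  shows "config3 V E l = {r. (\<forall>x. x \<notin> V \<longrightarrow> r x = 0) \<and> edge_equivalent E p r}"
proof -
  have "(norm (p x - p y))\<^sup>2 = l {x, y}" if "{x, y} \<in> E" for x y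
    using assms that by (auto simp: config3_def)
  then show ?thesis
    by (auto simp: config3_def edge_equivalent_def dist_norm)
      (metis norm_ge_zero power2_eq_iff_nonneg)
qed

lemma cayley_map_cong:
  assumes "edge_equivalent (graph_union E F) q r"
  shows "cayley_map F q = cayley_map F r"
  unfolding cayley_map_def
proof (rule map_cong[OF refl], clarify)
  fix u v assume "(u, v) \<in> set F"
  then have "{u, v} \<in> graph_union E F"
    by (force simp: graph_union_def)
  then show "(norm (q u - q v))\<^sup>2 = (norm (r u - r v))\<^sup>2"
    using assms by (simp add: edge_equivalent_def dist_norm)
qed

theorem mainTheorem5:
  fixes V :: "'a set" and E :: "'a set set" and F :: "('a \<times> 'a) list"
  assumes "simple_graph V E"
    and "nonedges V E F"
    and "partial_three_tree V (graph_union E F)"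
  shows "covering_map_property3 V E F"
  unfolding covering_map_property3_def Omega3_def
proof (intro allI impI ballI)
  fix l p assume p: "p \<in> config3 V E l"
  note config3 = config3_eq_edge_equivalent[OF p]
  have graph: "\<Union>(graph_union E F) \<subseteq> V" "E \<subseteq> graph_union E F"
    using assms(1,2) by (auto simp: simple_graph_def nonedges_def graph_union_def)
  show "cayley_map F ` connected_component_set (config3 V E l) p = cayley_map F ` config3 V E l"
  proof
    show "cayley_map F ` connected_component_set (config3 V E l) p \<subseteq> cayley_map F ` config3 V E l"
      by (intro image_mono connected_component_subset)
    show "cayley_map F ` config3 V E l \<subseteq> cayley_map F ` connected_component_set (config3 V E l) p"
    proof clarify
      fix q assume "q \<in> config3 V E l"
      then have "edge_equivalent E p q" "\<And>x. x \<notin> V \<Longrightarrow> p x = 0"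
        using p config3 by auto
      then obtain r where r: "edge_equivalent (graph_union E F) q r"
          "connected_component (config3 V E l) p r"
        using partial_three_tree_component_reaches[OF assms(3) graph] unfolding config3 by blast
      then show "cayley_map F q \<in> cayley_map F ` connected_component_set (config3 V E l) p"
        using cayley_map_cong[OF r(1)] by blast
    qed
  qed
qed

end
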